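(* Let $n\in\mathbb N$ and let $\pi=\pi_{\mathrm g=n}$ be the projection according to the word length grading. Then for any family of vectors $\mathbf V$, any words $u,v\in\mathbb A^*$ and any linear endomorphisms $X,Y$ of $\mathbb R\langle\mathbb A\rangle_*$: (i) $E\circ|S|=E$; (ii) $|S|(u*v)=\bigl(|S|(u)\bigr)*\bigl(|S|(v)\bigr)$; (iii) $\langle|S|\circ X,Y\rangle=\langle X,|S|\circ Y\rangle$; (iv) $\langle X,Y\rangle=\langle|S|\circ X,|S|\circ Y\rangle$; (v) $\|\pi\circ S\|^2=\|\pi\circ\mathrm{id}\|^2$; (vi) $\bigl\langle\pi\circ\tfrac12(\mathrm{id}-S)\,,\,\pi\circ\tfrac12(\mathrm{id}+S)\bigr\rangle=0$.
   Context: Alphabet: let $W^0_t\equiv t$, $W^1,\dots,W^d$ be Wiener processes and $J^i_t=\int_0^t\int_{\mathbb R}v\,\overline Q^i(\mathrm dv,\mathrm ds)$, $d<i\le\ell$, be purely discontinuous martingales, all independent and with moments of all orders, where $\overline Q^i$ is the compensation of a Poisson measure with intensity $\rho^i(\mathrm dv)\mathrm ds$. For $p\ge2$ put $J^{i^{(p)}}_t=\int_0^t\int_{\mathbb R}v^p\,\overline Q^i(\mathrm dv,\mathrm ds)$. The alphabet $\mathbb A$ consists of $0,1,\dots,\ell$ together with the letters $i^{(p)}$ ($p\ge2$, $d<i\le\ell$) for which $J^{i^{(p)}}$ is not in the linear span of $\{t,J^i,\dots,J^{i^{(p-1)}}\}$; $i^{(1)}=i$. $\mathbb A^*$ is the set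 of words over $\mathbb A$ and $\mathbb R\langle\mathbb A\rangle$ the vector space with basis $\mathbb A^*$. Quasi-shuffle algebra $\mathbb R\langle\mathbb A\rangle_*$: the product $*$ satisfies $u*\mathbf 1=\mathbf 1*u=u$ ($\mathbf 1$ the empty word) and $ua*vb=(u*vb)a+(ua*v)b+(u*v)[a,b]$ for words $u,v$, letters $a,b$, where $[\cdot,\cdot]$ is the commutative associative bilinear product on the span of the letters with $[0,a]=0$ for all $a$; $[i,j]=\delta_{ij}\cdot 0$ (multiple of the letter $0$) for $i,j\in\{1,\dots,d\}$; $[i^{(p)},j^{(q)}]=0$ for $i\ne j$; $[i^{(p)},i^{(q)}]=\bigl(\int v^{p+q}\rho^i(\mathrm dv)\bigr)\cdot 0+i^{(p+q)}$ for $i>d$ (where $0$ is the letter $0$, and if $i^{(p+q)}\notin\mathbb A$ it stands for the linear combination of letters representing $J^{i^{(p+q)}}$). Maps: $|S|(a_1\ldots a_m)=a_m\ldots a_1$ and $S(a_1\ldots a_m)=(-1)^ma_m\ldots a_1$, extended linearly. $\pi_{\mathrm g=n}$ is the linear projection fixing words of length $n$ and sending all other words to $0$. The expectation map $E:\mathbb R\langle\mathbb A\rangle\to\mathbb R[t]$ is the linear map with $E(w)=t^{|w|}/|w|!$ if every letter of $w$ is $0$ (including the empty word) and $E(w)=0$ otherwise. Inner product: $\mathbf V$ is given by a family of (indeterminate) vectors $\{\mathbf V_w\}_{w\in\mathbb A^*}$, $(u,v)=\mathbf V_u^{\mathrm T}\mathbf V_v$, and for linear endomorphisms $X,Y$ of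 $\mathbb R\langle\mathbb A\rangle_*$ $$\langle X,Y\rangle=\sum_{u,v\in\mathbb A^*}E\bigl(X(u)*Y(v)\bigr)\,(u,v),\qquad\|X\|^2=\langle X,X\rangle,$$ the sums being understood formally in the symbols $(u,v)$ (or assumed convergent). *)

theory Defs
  imports
    "HOL-Probability.Probability"
    "HOL-Computational_Algebra.Polynomial"
    "HOL-Library.Poly_Mapping"
    "HOL-Library.Uprod"
begin

section \<open>Free real vector spaces\<close>

instantiation poly_mapping :: (type, real_vector) real_vector
begin

lift_definition scaleR_poly_mapping :: "real \<Rightarrow> ('a \<Rightarrow>\<^sub>0 'b) \<Rightarrow> 'a \<Rightarrow>\<^sub>0 'b"
  is "\<lambda>c f k. c *\<^sub>R f k"
  by (rule finite_subset) auto

instance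
  by standard (transfer; simp add: fun_eq_iff scaleR_add_left scaleR_add_right)+

end

abbreviation gen :: "'a \<Rightarrow> 'a \<Rightarrow>\<^sub>0 real"
  where "gen k \<equiv> Poly_Mapping.single k 1"

definition lin_ext :: "('a \<Rightarrow> 'b::real_vector) \<Rightarrow> ('a \<Rightarrow>\<^sub>0 real) \<Rightarrow> 'b"
  where "lin_ext f x = (\<Sum>k\<in>Poly_Mapping.keys x. Poly_Mapping.lookup x k *\<^sub>R f k)"


section \<open>Driving processes\<close>

definition wiener_process :: "'a measure \<Rightarrow> (real \<Rightarrow> 'a \<Rightarrow> real) \<Rightarrow> bool" where
  "wiener_process M W \<longleftrightarrow>
     (\<forall>t\<ge>0. W t \<in> borel_measurable M) \<and>
     (AE \<omega> in M. W 0 \<omega> = 0) \<and>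
     (AE \<omega> in M. continuous_on {0..} (\<lambda>t. W t \<omega>)) \<and>
     (\<forall>s t. 0 \<le> s \<longrightarrow> s < t \<longrightarrow>
        distributed M lborel (\<lambda>\<omega>. W t \<omega> - W s \<omega>)
          (\<lambda>x. ennreal (normal_density 0 (sqrt (t - s)) x))) \<and>
     (\<forall>(\<tau> :: nat \<Rightarrow> real) n. 0 \<le> \<tau> 0 \<longrightarrow> mono \<tau> \<longrightarrow>
        prob_space.indep_vars M (\<lambda>_. borel)
          (\<lambda>k \<omega>. W (\<tau> (Suc k)) \<omega> - W (\<tau> k) \<omega>) {..<n})"

definition poisson_random_measure :: "'a measure \<Rightarrow> 'b measure \<Rightarrow> ('a \<Rightarrow> 'b measure) \<Rightarrow> bool" where
  "poisson_random_measure M \<mu> Q \<longleftrightarrow>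
     (\<forall>\<omega>\<in>space M. sets (Q \<omega>) = sets \<mu>) \<and>
     (\<forall>A\<in>sets \<mu>. (\<lambda>\<omega>. emeasure (Q \<omega>) A) \<in> borel_measurable M) \<and>
     (\<forall>A\<in>sets \<mu>. emeasure \<mu> A < \<infinity> \<longrightarrow>
        (\<forall>k::nat. measure M {\<omega>\<in>space M. emeasure (Q \<omega>) A = of_nat k} =
           exp (- measure \<mu> A) * measure \<mu> A ^ k / fact k)) \<and>
     (\<forall>A\<in>sets \<mu>. emeasure \<mu> A = \<infinity> \<longrightarrow> (AE \<omega> in M. emeasure (Q \<omega>) A = \<infinity>)) \<and>
     (\<forall>(A :: nat \<Rightarrow> 'b set) n. disjoint_family_on A {..<n} \<longrightarrow> A ` {..<n} \<subseteq> sets \<mu> \<longrightarrow>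
        prob_space.indep_vars M (\<lambda>_. borel) (\<lambda>k \<omega>. emeasure (Q \<omega>) (A k)) {..<n})"

definition levy_measure :: "real measure \<Rightarrow> bool" where
  "levy_measure \<rho> \<longleftrightarrow> sets \<rho> = sets borel \<and> emeasure \<rho> {0} = 0 \<and>
     (\<integral>\<^sup>+ v. ennreal (min 1 (v\<^sup>2)) \<partial>\<rho>) < \<infinity>"

definition jump_intensity :: "real measure \<Rightarrow> (real \<times> real) measure" where
  "jump_intensity \<rho> = \<rho> \<Otimes>\<^sub>M density lborel (indicator {0..})"

definition cadlag :: "(real \<Rightarrow> real) \<Rightarrow> bool" where
  "cadlag f \<longleftrightarrow> (\<forall>t\<ge>0. continuous (at_right t) f \<and> (0 < t \<longrightarrow> (\<exists>l. (f \<longlongrightarrow> l) (at_left t))))"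

definition comp_poisson_integral_trunc ::
  "real measure \<Rightarrow> ('a \<Rightarrow> (real \<times> real) measure) \<Rightarrow> (real \<Rightarrow> real) \<Rightarrow> real \<Rightarrow> real \<Rightarrow> 'a \<Rightarrow> real" where
  "comp_poisson_integral_trunc \<rho> Q f \<epsilon> t \<omega> =
     (LINT (v, s) : {v. \<epsilon> < \<bar>v\<bar>} \<times> {0<..t} | Q \<omega>. f v) - t * (LINT v : {v. \<epsilon> < \<bar>v\<bar>} | \<rho>. f v)"

text \<open>
  The compensated integral of \<open>f\<close> over \<open>\<real> \<times> (0, t]\<close> is the limit in mean square of the
  integrals over the jumps larger than \<open>\<epsilon>\<close>.  The truncation is needed because small jumps
  need not be summable, so that the integral and its compensator need not exist separately.
\<close>

definition comp_poisson_integral ::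
  "'a measure \<Rightarrow> real measure \<Rightarrow> ('a \<Rightarrow> (real \<times> real) measure) \<Rightarrow> (real \<Rightarrow> real) \<Rightarrow>
   (real \<Rightarrow> 'a \<Rightarrow> real) \<Rightarrow> bool" where
  "comp_poisson_integral M \<rho> Q f Z \<longleftrightarrow>
     (\<forall>t\<ge>0. Z t \<in> borel_measurable M \<and>
        ((\<lambda>\<epsilon>. \<integral>\<^sup>+ \<omega>. ennreal ((comp_poisson_integral_trunc \<rho> Q f \<epsilon> t \<omega> - Z t \<omega>)\<^sup>2) \<partial>M)
           \<longlongrightarrow> 0) (at_right 0)) \<and>
     (AE \<omega> in M. cadlag (\<lambda>t. Z t \<omega>))"


section \<open>The alphabet\<close>

text \<open>
  The pair \<open>(i, p)\<close> encodes the letter \<open>i\<^sup>(\<^sup>p\<^sup>)\<close>; in particular \<open>(i, 1)\<close> is the letter \<open>i\<close>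
  and \<open>(0, 1)\<close> the letter \<open>0\<close>.  \<open>J i p\<close> is the process of the letter \<open>i\<^sup>(\<^sup>p\<^sup>)\<close> for \<open>i > d\<close>.
\<close>

type_synonym letter = "nat \<times> nat"

abbreviation letter0 :: letter where "letter0 \<equiv> (0, 1)"

definition letter_process ::
  "nat \<Rightarrow> (nat \<Rightarrow> real \<Rightarrow> 'a \<Rightarrow> real) \<Rightarrow> (nat \<Rightarrow> nat \<Rightarrow> real \<Rightarrow> 'a \<Rightarrow> real) \<Rightarrow>
   letter \<Rightarrow> real \<Rightarrow> 'a \<Rightarrow> real" where
  "letter_process d W J a t \<omega> =
     (case a of (i, p) \<Rightarrow> if i = 0 then t else if i \<le> d then W i t \<omega> else J i p t \<omega>)"

text \<open>Processes are identified when they are indistinguishable.\<close>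

definition represents ::
  "'a measure \<Rightarrow> nat \<Rightarrow> (nat \<Rightarrow> real \<Rightarrow> 'a \<Rightarrow> real) \<Rightarrow> (nat \<Rightarrow> nat \<Rightarrow> real \<Rightarrow> 'a \<Rightarrow> real) \<Rightarrow>
   (letter \<Rightarrow>\<^sub>0 real) \<Rightarrow> (real \<Rightarrow> 'a \<Rightarrow> real) \<Rightarrow> bool" where
  "represents M d W J x Z \<longleftrightarrow>
     (AE \<omega> in M. \<forall>t\<ge>0. Z t \<omega> = lin_ext (\<lambda>a. letter_process d W J a t \<omega>) x)"

definition alphabet ::
  "'a measure \<Rightarrow> nat \<Rightarrow> nat \<Rightarrow> (nat \<Rightarrow> real \<Rightarrow> 'a \<Rightarrow> real) \<Rightarrow> (nat \<Rightarrow> nat \<Rightarrow> real \<Rightarrow> 'a \<Rightarrow> real) \<Rightarrow>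
   letter set" where
  "alphabet M d l W J =
     {(i, 1) | i. i \<le> l} \<union>
     {(i, p) | i p. d < i \<and> i \<le> l \<and> 2 \<le> p \<and>
        \<not> (\<exists>x. Poly_Mapping.keys x \<subseteq> insert letter0 {(i, q) | q. 1 \<le> q \<and> q < p} \<and>
               represents M d W J x (J i p))}"

locale driving_processes = prob_space M
  for M :: "'a measure" +
  fixes d l :: nat
    and W :: "nat \<Rightarrow> real \<Rightarrow> 'a \<Rightarrow> real"
    and \<rho> :: "nat \<Rightarrow> real measure"
    and Q :: "nat \<Rightarrow> 'a \<Rightarrow> (real \<times> real) measure"
    and J :: "nat \<Rightarrow> nat \<Rightarrow> real \<Rightarrow> 'a \<Rightarrow> real"
  assumes d_le_l: "d \<le> l"
    and wiener: "i \<in> {1..d} \<Longrightarrow> wiener_process M (W i)"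
    and levy: "i \<in> {d<..l} \<Longrightarrow> levy_measure (\<rho> i)"
    and poisson: "i \<in> {d<..l} \<Longrightarrow> poisson_random_measure M (jump_intensity (\<rho> i)) (Q i)"
    and jump_integral: "i \<in> {d<..l} \<Longrightarrow> 1 \<le> p \<Longrightarrow>
          comp_poisson_integral M (\<rho> i) (Q i) (\<lambda>v. v ^ p) (J i p)"
    and independent:
          "indep_vars (\<lambda>_. PiM {0..} (\<lambda>_. borel))
             (\<lambda>i \<omega>. \<lambda>t\<in>{0..}. letter_process d W J (i, 1) t \<omega>) {1..l}"
    and moments: "i \<in> {1..l} \<Longrightarrow> 0 \<le> t \<Longrightarrow>
          integrable M (\<lambda>\<omega>. \<bar>letter_process d W J (i, 1) t \<omega>\<bar> ^ p)"

text \<open>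
  A bilinear product on the span of the letters, given by its values on pairs of letters.  In
  the last clause \<open>x\<close> is what the symbol \<open>i\<^sup>(\<^sup>p\<^sup>+\<^sup>q\<^sup>)\<close> stands for.
\<close>

definition letter_bracket ::
  "'a measure \<Rightarrow> nat \<Rightarrow> nat \<Rightarrow> (nat \<Rightarrow> real \<Rightarrow> 'a \<Rightarrow> real) \<Rightarrow> (nat \<Rightarrow> real measure) \<Rightarrow>
   (nat \<Rightarrow> nat \<Rightarrow> real \<Rightarrow> 'a \<Rightarrow> real) \<Rightarrow> (letter \<Rightarrow> letter \<Rightarrow> letter \<Rightarrow>\<^sub>0 real) \<Rightarrow> bool" where
  "letter_bracket M d l W \<rho> J br \<longleftrightarrow>
     (let A = alphabet M d l W J in
       (\<forall>a\<in>A. \<forall>b\<in>A. Poly_Mapping.keys (br a b) \<subseteq> A) \<and>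
       (\<forall>a\<in>A. \<forall>b\<in>A. br a b = br b a) \<and>
       (\<forall>a\<in>A. \<forall>b\<in>A. \<forall>c\<in>A. lin_ext (\<lambda>e. br e c) (br a b) = lin_ext (\<lambda>e. br a e) (br b c)) \<and>
       (\<forall>a\<in>A. br letter0 a = 0) \<and>
       (\<forall>i\<in>{1..d}. \<forall>j\<in>{1..d}. br (i, 1) (j, 1) = (if i = j then gen letter0 else 0)) \<and>
       (\<forall>i p j q. (i, p) \<in> A \<longrightarrow> (j, q) \<in> A \<longrightarrow> i \<noteq> j \<longrightarrow> br (i, p) (j, q) = 0) \<and>
       (\<forall>i p q. d < i \<longrightarrow> (i, p) \<in> A \<longrightarrow> (i, q) \<in> A \<longrightarrow>
          (\<exists>x. (if (i, p + q) \<in> A then x = gen (i, p + q)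
                else Poly_Mapping.keys x \<subseteq> A \<and> represents M d W J x (J i (p + q))) \<and>
               br (i, p) (i, q) = (\<integral>v. v ^ (p + q) \<partial>\<rho> i) *\<^sub>R gen letter0 + x)))"


section \<open>The quasi-shuffle algebra\<close>

type_synonym word_alg = "letter list \<Rightarrow>\<^sub>0 real"

definition word_space :: "letter set \<Rightarrow> word_alg set" where
  "word_space A = {x. Poly_Mapping.keys x \<subseteq> lists A}"

definition append_letters :: "word_alg \<Rightarrow> (letter \<Rightarrow>\<^sub>0 real) \<Rightarrow> word_alg" where
  "append_letters x y = lin_ext (\<lambda>w. lin_ext (\<lambda>a. gen (w @ [a])) y) x"

text \<open>The recursion peels off last letters, so the two argument words are stored reversed.\<close>

fun qshuffle_rev ::
  "(letter \<Rightarrow> letter \<Rightarrow> letter \<Rightarrow>\<^sub>0 real) \<Rightarrow> letter list \<Rightarrow> letter list \<Rightarrow> word_alg" where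
  "qshuffle_rev br [] v = gen (rev v)"
| "qshuffle_rev br u [] = gen (rev u)"
| "qshuffle_rev br (a # u) (b # v) =
     append_letters (qshuffle_rev br u (b # v)) (gen a) +
     append_letters (qshuffle_rev br (a # u) v) (gen b) +
     append_letters (qshuffle_rev br u v) (br a b)"

definition qshuffle ::
  "(letter \<Rightarrow> letter \<Rightarrow> letter \<Rightarrow>\<^sub>0 real) \<Rightarrow> word_alg \<Rightarrow> word_alg \<Rightarrow> word_alg" where
  "qshuffle br x y = lin_ext (\<lambda>u. lin_ext (\<lambda>v. qshuffle_rev br (rev u) (rev v)) y) x"

lemma lin_ext_gen [simp]: "lin_ext f (gen k) = f k"
  by (simp add: lin_ext_def)

lemma qshuffle_unit:
  "qshuffle br (gen u) (gen []) = gen u" "qshuffle br (gen []) (gen u) = gen u"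
  by (cases u rule: rev_cases; simp add: qshuffle_def)+

lemma qshuffle_snoc:
  "qshuffle br (gen (u @ [a])) (gen (v @ [b])) =
     append_letters (qshuffle br (gen u) (gen (v @ [b]))) (gen a) +
     append_letters (qshuffle br (gen (u @ [a])) (gen v)) (gen b) +
     append_letters (qshuffle br (gen u) (gen v)) (br a b)"
  by (simp add: qshuffle_def)

definition abs_antipode :: "word_alg \<Rightarrow> word_alg" where
  "abs_antipode = lin_ext (\<lambda>w. gen (rev w))"

definition signed_reversal :: "word_alg \<Rightarrow> word_alg" where
  "signed_reversal = lin_ext (\<lambda>w. (- 1) ^ length w *\<^sub>R gen (rev w))"

definition length_proj :: "nat \<Rightarrow> word_alg \<Rightarrow> word_alg" where
  "length_proj n = lin_ext (\<lambda>w. if length w = n then gen w else 0)"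

definition expect_word :: "letter list \<Rightarrow> real poly" where
  "expect_word w = (if set w \<subseteq> {letter0} then monom (1 / fact (length w)) (length w) else 0)"

definition expect :: "word_alg \<Rightarrow> real poly" where
  "expect x = (\<Sum>w\<in>Poly_Mapping.keys x. smult (Poly_Mapping.lookup x w) (expect_word w))"

definition lin_endo :: "letter set \<Rightarrow> (word_alg \<Rightarrow> word_alg) \<Rightarrow> bool" where
  "lin_endo A X \<longleftrightarrow>
     (\<forall>x\<in>word_space A. X x \<in> word_space A) \<and>
     (\<forall>x\<in>word_space A. \<forall>y\<in>word_space A. X (x + y) = X x + X y) \<and>
     (\<forall>c. \<forall>x\<in>word_space A. X (c *\<^sub>R x) = c *\<^sub>R X x)"


section \<open>The inner product\<close>

definition ip_coeff ::
  "(letter \<Rightarrow> letter \<Rightarrow> letter \<Rightarrow>\<^sub>0 real) \<Rightarrow> (word_alg \<Rightarrow> word_alg) \<Rightarrow> (word_alg \<Rightarrow> word_alg) \<Rightarrow>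
   letter list \<Rightarrow> letter list \<Rightarrow> real poly" where
  "ip_coeff br X Y u v = expect (qshuffle br (X (gen u)) (Y (gen v)))"

text \<open>
  For indeterminate vectors the inner product is a formal linear combination of the symbols
  \<open>(u, v) = V\<^sub>u \<^sup>T V\<^sub>v\<close>, given here by its family of coefficients in \<open>\<real>[t]\<close>.  As
  \<open>(u, v) = (v, u)\<close>, the symbols are indexed by unordered pairs of words, and each symbol
  collects the (at most two) terms of the double sum in which it occurs.
\<close>

definition formal_ip ::
  "letter set \<Rightarrow> (letter \<Rightarrow> letter \<Rightarrow> letter \<Rightarrow>\<^sub>0 real) \<Rightarrow> (word_alg \<Rightarrow> word_alg) \<Rightarrow>
   (word_alg \<Rightarrow> word_alg) \<Rightarrow> letter list uprod \<Rightarrow> real poly" where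
  "formal_ip A br X Y s =
     (\<Sum>(u, v)\<in>{(u, v). u \<in> lists A \<and> v \<in> lists A \<and> Upair u v = s}. ip_coeff br X Y u v)"

text \<open>For actual vectors the double series is evaluated at a time \<open>t\<close>.\<close>

definition ip_term ::
  "(letter \<Rightarrow> letter \<Rightarrow> letter \<Rightarrow>\<^sub>0 real) \<Rightarrow> (letter list \<Rightarrow> real ^ 'm) \<Rightarrow> real \<Rightarrow>
   (word_alg \<Rightarrow> word_alg) \<Rightarrow> (word_alg \<Rightarrow> word_alg) \<Rightarrow> letter list \<times> letter list \<Rightarrow> real" where
  "ip_term br V t X Y = (\<lambda>(u, v). poly (ip_coeff br X Y u v) t * (V u \<bullet> V v))"

definition ip_converges ::
  "letter set \<Rightarrow> (letter \<Rightarrow> letter \<Rightarrow> letter \<Rightarrow>\<^sub>0 real) \<Rightarrow> (letter list \<Rightarrow> real ^ 'm) \<Rightarrow> real \<Rightarrow>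
   (word_alg \<Rightarrow> word_alg) \<Rightarrow> (word_alg \<Rightarrow> word_alg) \<Rightarrow> bool" where
  "ip_converges A br V t X Y \<longleftrightarrow> ip_term br V t X Y summable_on (lists A \<times> lists A)"

definition ip ::
  "letter set \<Rightarrow> (letter \<Rightarrow> letter \<Rightarrow> letter \<Rightarrow>\<^sub>0 real) \<Rightarrow> (letter list \<Rightarrow> real ^ 'm) \<Rightarrow> real \<Rightarrow>
   (word_alg \<Rightarrow> word_alg) \<Rightarrow> (word_alg \<Rightarrow> word_alg) \<Rightarrow> real" where
  "ip A br V t X Y = infsum (ip_term br V t X Y) (lists A \<times> lists A)"

end

theory Submission
  imports Defs
begin

text \<open>
  The quasi-shuffle product of two words is a sum over lattice paths built from the steps
  \<open>(1, 0)\<close>, \<open>(0, 1)\<close> and \<open>(1, 1)\<close>, and running the paths backwards reverses all words.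
  Formally, the recursion on last letters that defines the product implies the same recursion
  on first letters, so word reversal is multiplicative.  It also preserves the
  expectation.  All claims on inner products then hold coefficient by coefficient: reversal can
  be moved from one factor to the other, and on words of length \<open>n\<close> the antipode
  is reversal up to the constant sign \<open>(-1)\<^sup>n\<close>.
\<close>

lemma lookup_scaleR: "Poly_Mapping.lookup (c *\<^sub>R x) k = c *\<^sub>R Poly_Mapping.lookup x k"
  by transfer simp

lemma lin_ext_superset:
  assumes "finite K" "Poly_Mapping.keys x \<subseteq> K"
  shows "lin_ext f x = (\<Sum>k\<in>K. Poly_Mapping.lookup x k *\<^sub>R f k)"
  unfolding lin_ext_def
  by (rule sum.mono_neutral_left) (use assms in \<open>auto simp: in_keys_iff\<close>)

lemma linear_lin_ext [intro]: "linear (lin_ext f)"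
proof (rule linearI)
  fix x y :: "'a \<Rightarrow>\<^sub>0 real" and c :: real
  let ?K = "Poly_Mapping.keys x \<union> Poly_Mapping.keys y"
  have "Poly_Mapping.keys (x + y) \<subseteq> ?K" by (rule keys_add)
  then show "lin_ext f (x + y) = lin_ext f x + lin_ext f y"
    by (simp add: lin_ext_superset[of ?K] lookup_add scaleR_add_left sum.distrib)
  have "Poly_Mapping.keys (c *\<^sub>R x) \<subseteq> Poly_Mapping.keys x"
    by (auto simp: in_keys_iff lookup_scaleR)
  then show "lin_ext f (c *\<^sub>R x) = c *\<^sub>R lin_ext f x"
    by (simp add: lin_ext_superset[of "Poly_Mapping.keys x"] lookup_scaleR scaleR_sum_right)
qed

lemma linear_lin_ext_param:
  assumes "\<And>k. linear (\<lambda>y. f y k)"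
  shows "linear (\<lambda>y. lin_ext (f y) x)"
  unfolding lin_ext_def
  by (intro linear_compose_sum ballI linear_compose_scale_right assms)

lemma linear_eq_gen:
  assumes "linear f" "linear g" "\<And>k. f (gen k) = g (gen k)"
  shows "f x = g x"
proof -
  have x: "x = lin_ext gen x"
    by (rule poly_mapping_eqI)
      (auto simp: lin_ext_def lookup_sum lookup_scaleR lookup_single when_def in_keys_iff if_distrib
        cong: if_cong)
  show ?thesis
    by (subst (1 2) x)
      (simp only: lin_ext_def linear_sum[OF assms(1)] linear_sum[OF assms(2)]
        linear_scale[OF assms(1)] linear_scale[OF assms(2)] assms(3))
qed

lemma linear_append_letters_left: "linear (\<lambda>x. append_letters x y)"
  unfolding append_letters_def by (rule linear_lin_ext)

lemma linear_append_letters_right: "linear (append_letters x)"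
  unfolding append_letters_def by (intro linear_lin_ext_param linear_lin_ext)

lemma linear_qshuffle_left: "linear (\<lambda>x. qshuffle br x y)"
  unfolding qshuffle_def by (rule linear_lin_ext)

lemma linear_qshuffle_right: "linear (qshuffle br x)"
  unfolding qshuffle_def by (intro linear_lin_ext_param linear_lin_ext)

lemma linear_abs_antipode: "linear abs_antipode"
  unfolding abs_antipode_def by (rule linear_lin_ext)

lemma linear_length_proj: "linear (length_proj n)"
  unfolding length_proj_def by (rule linear_lin_ext)

lemma abs_antipode_gen [simp]: "abs_antipode (gen w) = gen (rev w)"
  by (simp add: abs_antipode_def)

lemma abs_antipode_abs_antipode [simp]: "abs_antipode (abs_antipode x) = x"
  by (rule linear_eq_gen[of "\<lambda>x. abs_antipode (abs_antipode x)" "\<lambda>x. x"])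
    (simp_all add: linear_compose[OF linear_abs_antipode linear_abs_antipode, unfolded o_def]
      linear_ident)

definition prepend_letters :: "(letter \<Rightarrow>\<^sub>0 real) \<Rightarrow> word_alg \<Rightarrow> word_alg" where
  "prepend_letters y x = lin_ext (\<lambda>w. lin_ext (\<lambda>a. gen (a # w)) y) x"

lemma linear_prepend_letters_right: "linear (prepend_letters y)"
  unfolding prepend_letters_def by (rule linear_lin_ext)

lemma linear_prepend_letters_left: "linear (\<lambda>y. prepend_letters y x)"
  unfolding prepend_letters_def by (intro linear_lin_ext_param linear_lin_ext)

lemma append_letters_gen [simp]: "append_letters (gen w) (gen a) = gen (w @ [a])"
  by (simp add: append_letters_def)

lemma prepend_letters_gen [simp]: "prepend_letters (gen a) (gen w) = gen (a # w)"
  by (simp add: prepend_letters_def)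

lemmas append_letters_add_left = linear_add[OF linear_append_letters_left]
lemmas prepend_letters_add_right = linear_add[OF linear_prepend_letters_right]
lemmas abs_antipode_add = linear_add[OF linear_abs_antipode]

lemma append_prepend_letters:
  "append_letters (prepend_letters y x) z = prepend_letters y (append_letters x z)"
proof -
  have 1: "append_letters (prepend_letters (gen a) (gen w)) z =
      prepend_letters (gen a) (append_letters (gen w) z)" for a w
    by (rule linear_eq_gen[where x = z])
      (simp_all add: linear_append_letters_right
        linear_compose[OF linear_append_letters_right linear_prepend_letters_right, unfolded o_def])
  have 2: "append_letters (prepend_letters y (gen w)) z =
      prepend_letters y (append_letters (gen w) z)" for w
    by (rule linear_eq_gen[where x = y])
      (simp_all only: 1 linear_prepend_letters_left
        linear_compose[OF linear_prepend_letters_left linear_append_letters_left, unfolded o_def])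
  show ?thesis
    by (rule linear_eq_gen[where x = x])
      (simp_all only: 2
        linear_compose[OF linear_append_letters_left linear_prepend_letters_right, unfolded o_def]
        linear_compose[OF linear_prepend_letters_right linear_append_letters_left, unfolded o_def])
qed

lemma abs_antipode_append_letters:
  "abs_antipode (append_letters x y) = prepend_letters y (abs_antipode x)"
proof -
  have 1: "abs_antipode (append_letters (gen w) y) = prepend_letters y (abs_antipode (gen w))" for w
    by (rule linear_eq_gen[where x = y])
      (auto intro: linear_prepend_letters_left
        linear_compose[OF linear_append_letters_right linear_abs_antipode, unfolded o_def])
  show ?thesis
    by (rule linear_eq_gen[where x = x])
      (simp_all only: 1
        linear_compose[OF linear_append_letters_left linear_abs_antipode, unfolded o_def]
        linear_compose[OF linear_abs_antipode linear_prepend_letters_right, unfolded o_def])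
qed

lemma append_gen_Cons:
  "append_letters (gen (a # w)) y = prepend_letters (gen a) (append_letters (gen w) y)"
  by (metis append_prepend_letters prepend_letters_gen)

lemma append_letters_Nil: "append_letters (gen []) y = prepend_letters y (gen [])"
  by (simp add: append_letters_def prepend_letters_def)

lemma qshuffle_Cons:
  "qshuffle br (gen (a # u)) (gen (b # v)) =
     prepend_letters (gen a) (qshuffle br (gen u) (gen (b # v))) +
     prepend_letters (gen b) (qshuffle br (gen (a # u)) (gen v)) +
     prepend_letters (br a b) (qshuffle br (gen u) (gen v))"
proof (induction "length u + length v" arbitrary: u v rule: less_induct)
  case less
  note lin = append_letters_add_left prepend_letters_add_right append_prepend_letters
  consider "u = []" "v = []"
    | v' c where "u = []" "v = v' @ [c]"
    | u' e where "u = u' @ [e]" "v = []"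
    | u' e v' c where "u = u' @ [e]" "v = v' @ [c]"
    by (metis rev_exhaust)
  then show ?case
  proof cases
    case 1
    then show ?thesis
      using qshuffle_snoc[of br "[]" a "[]" b]
      by (simp add: qshuffle_unit append_letters_Nil)
  next
    case 2
    have IH: "qshuffle br (gen [a]) (gen (b # v')) =
        prepend_letters (gen a) (gen (b # v')) +
        prepend_letters (gen b) (qshuffle br (gen [a]) (gen v')) +
        prepend_letters (br a b) (gen v')"
      using less[of "[]" v'] 2 by (simp add: qshuffle_unit)
    show ?thesis
      using qshuffle_snoc[of br "[]" a "b # v'" c] qshuffle_snoc[of br "[]" a v' c]
      by (simp add: 2 IH lin qshuffle_unit append_gen_Cons algebra_simps)
  next
    case 3
    have IH: "qshuffle br (gen (a # u')) (gen [b]) =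
        prepend_letters (gen a) (qshuffle br (gen u') (gen [b])) +
        prepend_letters (gen b) (gen (a # u')) +
        prepend_letters (br a b) (gen u')"
      using less[of u' "[]"] 3 by (simp add: qshuffle_unit)
    show ?thesis
      using qshuffle_snoc[of br "a # u'" e "[]" b] qshuffle_snoc[of br u' e "[]" b]
      by (simp add: 3 IH lin qshuffle_unit append_gen_Cons algebra_simps)
  next
    case 4
    have IH: "length p + length q < length u + length v \<Longrightarrow>
        qshuffle br (gen (a # p)) (gen (b # q)) =
        prepend_letters (gen a) (qshuffle br (gen p) (gen (b # q))) +
        prepend_letters (gen b) (qshuffle br (gen (a # p)) (gen q)) +
        prepend_letters (br a b) (qshuffle br (gen p) (gen q))" for p q
      by (rule less)
    note 1 = IH[of u' v] IH[of u v'] IH[of u' v']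
    show ?thesis
      using 1 qshuffle_snoc[of br "a # u'" e "b # v'" c] qshuffle_snoc[of br u' e "b # v'" c]
        qshuffle_snoc[of br "a # u'" e v' c] qshuffle_snoc[of br u' e v' c]
      by (simp add: 4 lin algebra_simps)
  qed
qed

lemma abs_antipode_qshuffle_gen:
  "abs_antipode (qshuffle br (gen u) (gen v)) = qshuffle br (gen (rev u)) (gen (rev v))"
proof (induction "length u + length v" arbitrary: u v rule: less_induct)
  case less
  show ?case
  proof (cases "u = [] \<or> v = []")
    case True
    then show ?thesis by (auto simp: qshuffle_unit)
  next
    case False
    then obtain u' a v' b where uv: "u = u' @ [a]" "v = v' @ [b]"
      by (metis rev_exhaust)
    show ?thesis
      using less[of u' v] less[of u v'] less[of u' v']
      by (simp add: uv qshuffle_snoc qshuffle_Cons abs_antipode_add abs_antipode_append_letters)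
  qed
qed

lemma abs_antipode_qshuffle:
  "abs_antipode (qshuffle br x y) = qshuffle br (abs_antipode x) (abs_antipode y)"
proof -
  have 1: "abs_antipode (qshuffle br (gen u) y) = qshuffle br (gen (rev u)) (abs_antipode y)" for u
    by (rule linear_eq_gen[where x = y])
      (simp_all only: abs_antipode_qshuffle_gen abs_antipode_gen
        linear_compose[OF linear_qshuffle_right linear_abs_antipode, unfolded o_def]
        linear_compose[OF linear_abs_antipode linear_qshuffle_right, unfolded o_def])
  show ?thesis
    by (rule linear_eq_gen[where x = x])
      (simp_all only: 1 abs_antipode_gen
        linear_compose[OF linear_qshuffle_left linear_abs_antipode, unfolded o_def]
        linear_compose[OF linear_abs_antipode linear_qshuffle_left, unfolded o_def])
qed

lemma coeff_expect: "coeff (expect x) k = lin_ext (\<lambda>w. coeff (expect_word w) k) x"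
  by (simp add: expect_def lin_ext_def coeff_sum)

lemma expect_add: "expect (x + y) = expect x + expect y"
  by (rule poly_eqI) (simp add: coeff_expect linear_add[OF linear_lin_ext])

lemma expect_scaleR: "expect (c *\<^sub>R x) = smult c (expect x)"
  by (rule poly_eqI) (simp add: coeff_expect linear_scale[OF linear_lin_ext])

lemma expect_abs_antipode: "expect (abs_antipode x) = expect x"
proof (rule poly_eqI)
  fix k
  have "lin_ext (\<lambda>w. coeff (expect_word w) k) (abs_antipode x) =
      lin_ext (\<lambda>w. coeff (expect_word w) k) x"
    by (rule linear_eq_gen[where x = x])
      (auto simp: expect_word_def
        intro: linear_compose[OF linear_abs_antipode linear_lin_ext, unfolded o_def])
  then show "coeff (expect (abs_antipode x)) k = coeff (expect x) k"
    by (simp add: coeff_expect)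
qed

lemma expect_qshuffle_abs_antipode:
  "expect (qshuffle br (abs_antipode x) (abs_antipode y)) = expect (qshuffle br x y)"
  by (metis abs_antipode_qshuffle expect_abs_antipode)

lemma expect_qshuffle_abs_antipode_left:
  "expect (qshuffle br (abs_antipode x) y) = expect (qshuffle br x (abs_antipode y))"
  by (metis expect_qshuffle_abs_antipode abs_antipode_abs_antipode)

lemma expect_qshuffle_antisym_sym:
  assumes "s * s = 1"
  shows "expect (qshuffle br (c *\<^sub>R (x - s *\<^sub>R abs_antipode x))
      (c' *\<^sub>R (y + s *\<^sub>R abs_antipode y))) = 0"
proof -
  have diff: "x - s *\<^sub>R abs_antipode x = x + (- s) *\<^sub>R abs_antipode x" by simp
  let ?p = "expect (qshuffle br x y)" and ?q = "expect (qshuffle br x (abs_antipode y))"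
  have "expect (qshuffle br (c *\<^sub>R (x - s *\<^sub>R abs_antipode x))
      (c' *\<^sub>R (y + s *\<^sub>R abs_antipode y))) =
      smult c (smult c' (?p + smult s ?q + smult (- s) (?q + smult s ?p)))"
    unfolding diff
    by (simp only: linear_add[OF linear_qshuffle_left] linear_add[OF linear_qshuffle_right]
        linear_scale[OF linear_qshuffle_left] linear_scale[OF linear_qshuffle_right]
        expect_add expect_scaleR expect_qshuffle_abs_antipode expect_qshuffle_abs_antipode_left
        abs_antipode_abs_antipode smult_add_right ac_simps smult_smult)
  also have "\<dots> = 0"
    using assms by (simp add: smult_add_right)
  finally show ?thesis .
qed

lemma length_proj_gen: "length_proj n (gen w) = (if length w = n then gen w else 0)"
  by (simp add: length_proj_def)

lemma signed_reversal_gen: "signed_reversal (gen w) = (- 1) ^ length w *\<^sub>R gen (rev w)"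
  by (simp add: signed_reversal_def)

lemma length_proj_signed_reversal_gen:
  "length_proj n (signed_reversal (gen w)) = (- 1) ^ n *\<^sub>R abs_antipode (length_proj n (gen w))"
  by (auto simp: signed_reversal_gen linear_scale[OF linear_length_proj] length_proj_gen
      linear_0[OF linear_abs_antipode])

lemma formal_ip_cong:
  "(\<And>u v. ip_coeff br X Y u v = ip_coeff br X' Y' u v) \<Longrightarrow>
     formal_ip A br X Y = formal_ip A br X' Y'"
  by (simp add: formal_ip_def fun_eq_iff)

lemma ip_cong:
  "(\<And>u v. ip_coeff br X Y u v = ip_coeff br X' Y' u v) \<Longrightarrow> ip A br V t X Y = ip A br V t X' Y'"
  by (simp add: ip_def ip_term_def)

theorem lemma4:
  fixes M :: "'a measure"
    and d l n :: nat
    and W :: "nat \<Rightarrow> real \<Rightarrow> 'a \<Rightarrow> real"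
    and \<rho> :: "nat \<Rightarrow> real measure"
    and Q :: "nat \<Rightarrow> 'a \<Rightarrow> (real \<times> real) measure"
    and J :: "nat \<Rightarrow> nat \<Rightarrow> real \<Rightarrow> 'a \<Rightarrow> real"
    and br :: "letter \<Rightarrow> letter \<Rightarrow> letter \<Rightarrow>\<^sub>0 real"
    and V :: "letter list \<Rightarrow> real ^ 'm"
    and t :: real
    and u v :: "letter list"
    and A :: "letter set"
    and X Y S absS \<pi> P R :: "word_alg \<Rightarrow> word_alg"
  assumes "driving_processes M d l W \<rho> Q J"
    and "letter_bracket M d l W \<rho> J br"
    and "A = alphabet M d l W J"
    and "u \<in> lists A" and "v \<in> lists A"
    and "lin_endo A X" and "lin_endo A Y"
    and "S = signed_reversal" and "absS = abs_antipode" and "\<pi> = length_proj n"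
    and "P = \<pi> \<circ> (\<lambda>x. (1 / 2) *\<^sub>R (x - S x))"
    and "R = \<pi> \<circ> (\<lambda>x. (1 / 2) *\<^sub>R (x + S x))"
  shows
    \<comment> \<open>(i)\<close>
    "(\<forall>x\<in>word_space A. (expect \<circ> absS) x = expect x) \<and>
    \<comment> \<open>(ii)\<close>
     absS (qshuffle br (gen u) (gen v)) = qshuffle br (absS (gen u)) (absS (gen v)) \<and>
    \<comment> \<open>(iii)\<close>
     formal_ip A br (absS \<circ> X) Y = formal_ip A br X (absS \<circ> Y) \<and>
     (ip_converges A br V t (absS \<circ> X) Y \<longrightarrow> ip_converges A br V t X (absS \<circ> Y) \<longrightarrow>
        ip A br V t (absS \<circ> X) Y = ip A br V t X (absS \<circ> Y)) \<and>
    \<comment> \<open>(iv)\<close>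
     formal_ip A br X Y = formal_ip A br (absS \<circ> X) (absS \<circ> Y) \<and>
     (ip_converges A br V t X Y \<longrightarrow> ip_converges A br V t (absS \<circ> X) (absS \<circ> Y) \<longrightarrow>
        ip A br V t X Y = ip A br V t (absS \<circ> X) (absS \<circ> Y)) \<and>
    \<comment> \<open>(v)\<close>
     formal_ip A br (\<pi> \<circ> S) (\<pi> \<circ> S) = formal_ip A br (\<pi> \<circ> id) (\<pi> \<circ> id) \<and>
     (ip_converges A br V t (\<pi> \<circ> S) (\<pi> \<circ> S) \<longrightarrow> ip_converges A br V t (\<pi> \<circ> id) (\<pi> \<circ> id) \<longrightarrow>
        ip A br V t (\<pi> \<circ> S) (\<pi> \<circ> S) = ip A br V t (\<pi> \<circ> id) (\<pi> \<circ> id)) \<and>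
    \<comment> \<open>(vi)\<close>
     formal_ip A br P R = (\<lambda>_. 0) \<and>
     (ip_converges A br V t P R \<longrightarrow> ip A br V t P R = 0)"
proof -
  note defs = assms(8-12)
  have sgn: "(- 1) ^ n * (- 1) ^ n = (1 :: real)"
    by (simp flip: power_mult_distrib)
  have iii: "ip_coeff br (absS \<circ> X) Y p q = ip_coeff br X (absS \<circ> Y) p q" for p q
    by (simp add: ip_coeff_def defs expect_qshuffle_abs_antipode_left)
  have iv: "ip_coeff br X Y p q = ip_coeff br (absS \<circ> X) (absS \<circ> Y) p q" for p q
    by (simp add: ip_coeff_def defs expect_qshuffle_abs_antipode)
  have v: "ip_coeff br (\<pi> \<circ> S) (\<pi> \<circ> S) p q = ip_coeff br (\<pi> \<circ> id) (\<pi> \<circ> id) p q" for p q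
    by (simp add: ip_coeff_def defs length_proj_signed_reversal_gen sgn
        linear_scale[OF linear_qshuffle_left] linear_scale[OF linear_qshuffle_right]
        expect_scaleR expect_qshuffle_abs_antipode)
  have vi: "ip_coeff br P R p q = 0" for p q
    using expect_qshuffle_antisym_sym[OF sgn]
    by (simp add: ip_coeff_def defs length_proj_signed_reversal_gen
        linear_scale[OF linear_length_proj] linear_add[OF linear_length_proj]
        linear_diff[OF linear_length_proj])
  have vi_formal: "formal_ip A br P R = (\<lambda>_. 0)"
    by (simp add: formal_ip_def vi fun_eq_iff)
  have vi_ip: "ip A br V t P R = 0"
    unfolding ip_def by (rule infsum_0) (auto simp: ip_term_def vi)
  show ?thesis
    by (intro conjI ballI impI formal_ip_cong ip_cong iii iv v vi_formal vi_ip)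
      (simp_all add: defs expect_abs_antipode abs_antipode_qshuffle_gen)
qed

end
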